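(* Let $p>1$ be an integer and let $H$ be a finite family of $d$-intervals satisfying the $(p,p)$ property. Then $$\tau^*(H) < p^{\frac{1}{p-1}}d^{\frac{1}{p-1}} + 1 \qquad\text{and}\qquad \tau(H) < p^{\frac{1}{p-1}}d^{\frac{p}{p-1}} + d.$$ Moreover, the bound on $\tau^*(H)$ is asymptotically sharp: for every integer $p>1$ there are infinitely many $d$ for which some finite family $F$ of $d$-intervals satisfying the $(p,p)$ property has $\tau^*(F)=\Omega(d^{\frac{1}{p-1}})$.
   Context: A $d$-interval is a union of at most $d$ disjoint closed intervals on the real line; a single point counts as a closed interval. A family of sets satisfies the $(p,q)$ property if among any $p$ members of it some $q$ have a common point. For a family $H$ of $d$-intervals, $\tau(H)$ is the minimum number of points of $\mathbb{R}$ needed so that every member of $H$ contains one of them. $\tau^*(H)$ is the fractional covering number: the minimum of $\sum_x g(x)$ over nonnegative finitely supported weight functions $g$ on $\mathbb{R}$ with $\sum_{x\in h} g(x)\ge 1$ for every $h\in H$. By LP duality, $\tau^*(H)$ equals the fractional matching number $\nu^*(H)$.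
   Formalization: The family H is additionally assumed to have at least p members; otherwise the (p,p) property is vacuous and the bounds fail (e.g. 99 distinct points, d = 1, p = 100). *)

theory Defs
  imports Complex_Main
begin

definition d_interval :: "nat \<Rightarrow> real set \<Rightarrow> bool" where
  "d_interval d h \<longleftrightarrow>
     (\<exists>J. finite J \<and> card J \<le> d \<and> pairwise disjnt J \<and>
          (\<forall>I\<in>J. \<exists>a b. a \<le> b \<and> I = {a..b}) \<and> h = \<Union>J)"

text \<open>The members are pairwise distinct, so the property is vacuous for families with
  fewer than \<open>p\<close> members.\<close>

definition pq_property :: "nat \<Rightarrow> nat \<Rightarrow> 'a set set \<Rightarrow> bool" where
  "pq_property p q H \<longleftrightarrow>
     (\<forall>G\<subseteq>H. finite G \<and> card G = p \<longrightarrow> (\<exists>G'\<subseteq>G. card G' = q \<and> \<Inter>G' \<noteq> {}))"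

text \<open>The two covering numbers below are meaningful only if a (fractional) cover exists.
  For a finite family this means that the empty set is not a member; a family with at least
  \<open>p\<close> members and the \<open>(p,p)\<close> property, \<open>p > 0\<close>, satisfies this.\<close>

definition covering_number :: "real set set \<Rightarrow> nat" where
  "covering_number H = (LEAST n. \<exists>P. finite P \<and> card P = n \<and> (\<forall>h\<in>H. h \<inter> P \<noteq> {}))"

definition fractional_cover :: "real set set \<Rightarrow> (real \<Rightarrow> real) \<Rightarrow> bool" where
  "fractional_cover H g \<longleftrightarrow>
     (\<forall>x. 0 \<le> g x) \<and> finite {x. g x \<noteq> 0} \<and>
     (\<forall>h\<in>H. (\<Sum>x | x \<in> h \<and> g x \<noteq> 0. g x) \<ge> 1)"

text \<open>For finite coverable \<open>H\<close> the infimum is attained (linear programming), so it is the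
  minimum.\<close>

definition fractional_covering_number :: "real set set \<Rightarrow> real" where
  "fractional_covering_number H = Inf {(\<Sum>x | g x \<noteq> 0. g x) | g. fractional_cover H g}"

end

theory Submission
  imports Defs "HOL-Library.FuncSet"
begin

text \<open>Let \<open>w\<close> be nonnegative weights of total \<open>W\<close> on the members. Any
  \<open>p\<close> members, repetitions allowed, have a common point, hence one that is a left end of
  one of them. Summing products of weights over all \<open>p\<close>-tuples gives
  \<open>W ^ p \<le> p * d * W * M ^ (p - 1)\<close>, where \<open>M\<close> is the largest weight of the
  members through a left end. So some point carries at least the fraction
  \<open>(p * d) powr (- 1 / (p - 1))\<close> of any weighting, and by minimax there is a fractional
  cover of total weight arbitrarily close to \<open>(p * d) powr (1 / (p - 1))\<close>. A fractional
  cover of total weight \<open>T\<close> turns into a cover by at most \<open>d * T\<close> of its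
  quantiles. Sharpness is witnessed by \<open>n\<close> members in which every
  \<open>p\<close> meet in a private point.\<close>

section \<open>Elementary inequalities and approximate minimax\<close>

lemma sum_UN_le:
  fixes f :: "'b \<Rightarrow> real"
  assumes "finite K" "\<And>k. k \<in> K \<Longrightarrow> finite (T k)" "\<And>t. 0 \<le> f t"
  shows "sum f (\<Union>k\<in>K. T k) \<le> (\<Sum>k\<in>K. sum f (T k))"
  using assms(1,2)
proof (induction K rule: finite_induct)
  case (insert k K)
  have "sum f (\<Union>k\<in>insert k K. T k) \<le> sum f (T k) + sum f (\<Union>k\<in>K. T k)"
    using sum.union_inter[of "T k" "\<Union>k\<in>K. T k" f] insert
      sum_nonneg[of "T k \<inter> (\<Union>k\<in>K. T k)" f] assms(3) by simp
  with insert show ?case by fastforce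
qed simp

text \<open>The squared positive part has derivative \<open>2 * max 0 a\<close> and curvature at
  most 2, so its first-order expansion falls short by at most the square of
  \<open>b\<close>.\<close>

lemma max_0_add_power2_le:
  fixes a b :: real
  shows "(max 0 (a + b))\<^sup>2 \<le> (max 0 a)\<^sup>2 + 2 * max 0 a * b + b\<^sup>2"
proof (cases "a \<ge> 0")
  case True
  then have "(max 0 (a + b))\<^sup>2 \<le> (a + b)\<^sup>2"
    by (simp add: max_def)
  with True show ?thesis by (simp add: power2_sum)
next
  case False
  then have "(max 0 (a + b))\<^sup>2 \<le> b\<^sup>2"
    by (intro abs_le_square_iff[THEN iffD1]) auto
  with False show ?thesis by (simp add: max_def)
qed

text \<open>The approximate form of von Neumann's theorem needs neither compactness nor
  separation: if the infimum of the potential \<open>\<Phi>\<close> were positive, then a step of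
  length \<open>\<epsilon>\<close> from a near-optimal \<open>g\<close> towards the best response to the
  weights \<open>max 0 (v - y g h)\<close> would bring \<open>\<Phi>\<close> below its infimum.\<close>

lemma approximate_minimax:
  fixes A :: "'h \<Rightarrow> 'x \<Rightarrow> real"
  assumes finH: "finite H" and finX: "finite X" and neX: "X \<noteq> {}"
    and A: "\<And>h x. 0 \<le> A h x" "\<And>h x. A h x \<le> 1"
    and resp: "\<And>w. (\<And>h. 0 \<le> w h) \<Longrightarrow> \<exists>x\<in>X. v * (\<Sum>h\<in>H. w h) \<le> (\<Sum>h\<in>H. w h * A h x)"
    and "u < v"
  obtains g where "\<And>x. 0 \<le> g x" "(\<Sum>x\<in>X. g x) = 1" "\<And>h. h \<in> H \<Longrightarrow> u \<le> (\<Sum>x\<in>X. g x * A h x)"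
proof -
  define D where "D = {g :: 'x \<Rightarrow> real. (\<forall>x. 0 \<le> g x) \<and> (\<Sum>x\<in>X. g x) = 1}"
  define y where "y g h = (\<Sum>x\<in>X. g x * A h x)" for g h
  define \<Phi> where "\<Phi> g = (\<Sum>h\<in>H. (max 0 (v - y g h))\<^sup>2)" for g
  define I where "I = Inf (\<Phi> ` D)"
  obtain x0 where "x0 \<in> X" using neX by auto
  then have "(\<lambda>x. if x = x0 then 1 else 0) \<in> D"
    using finX by (auto simp: D_def)
  then have neD: "\<Phi> ` D \<noteq> {}" by auto
  have \<Phi>_nonneg: "0 \<le> \<Phi> g" for g
    by (auto simp: \<Phi>_def intro!: sum_nonneg)
  then have bdd: "bdd_below (\<Phi> ` D)" by (intro bdd_belowI[of _ 0]) auto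
  have I_le: "I \<le> \<Phi> g" if "g \<in> D" for g
    unfolding I_def using that bdd by (intro cInf_lower) auto
  have "I \<le> 0"
  proof (rule ccontr)
    assume "\<not> I \<le> 0"
    then have Ipos: "I > 0" by simp
    define N where "N = real (card H)"
    \<comment> \<open>\<open>\<epsilon> \<le> 1\<close> keeps \<open>g'\<close> a convex
      combination. \<open>\<epsilon> * N \<le> I\<close> makes the quadratic error cost at most half
      of the first-order gain, which is at least \<open>2 * \<epsilon> * I\<close>.\<close>
    define \<epsilon> where "\<epsilon> = min 1 (I / (N + 1))"
    have N: "N \<ge> 0" by (simp add: N_def)
    have \<epsilon>: "0 < \<epsilon>" "\<epsilon> \<le> 1" using Ipos N by (auto simp: \<epsilon>_def)
    have "\<epsilon> * N \<le> \<epsilon> * (N + 1)" using \<epsilon> by simp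
    also have "\<dots> \<le> I / (N + 1) * (N + 1)"
      using N by (intro mult_right_mono) (auto simp: \<epsilon>_def)
    finally have \<epsilon>N: "\<epsilon> * N \<le> I" using N by simp
    \<comment> \<open>The excess of \<open>g\<close> over the infimum is kept below
      \<open>\<epsilon> * I\<close>, the part of the gain that survives the quadratic error.\<close>
    have "I < I + \<epsilon> * I" using \<epsilon> Ipos by simp
    then obtain g where g: "g \<in> D" "\<Phi> g < I + \<epsilon> * I"
      using cInf_lessD[OF neD] unfolding I_def by (metis imageE)
    define w where "w h = max 0 (v - y g h)" for h
    obtain x where x: "x \<in> X" "v * (\<Sum>h\<in>H. w h) \<le> (\<Sum>h\<in>H. w h * A h x)"
      using resp[of w] by (auto simp: w_def)
    define g' where "g' z = (1 - \<epsilon>) * g z + \<epsilon> * (if z = x then 1 else 0)" for z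
    have "g' \<in> D"
      using g(1) \<epsilon> x(1) finX
      by (auto simp: D_def g'_def sum.distrib simp flip: sum_distrib_left)
    have y': "y g' h = y g h + \<epsilon> * (A h x - y g h)" for h
    proof -
      have "y g' h = (\<Sum>z\<in>X. (1 - \<epsilon>) * (g z * A h z) + \<epsilon> * (if z = x then A h z else 0))"
        unfolding y_def g'_def by (intro sum.cong refl) (auto simp: algebra_simps)
      also have "\<dots> = (1 - \<epsilon>) * y g h + \<epsilon> * A h x"
        using x(1) finX by (simp add: sum.distrib y_def flip: sum_distrib_left)
      finally show ?thesis by (simp add: algebra_simps)
    qed
    have y01: "0 \<le> y g h" "y g h \<le> 1" for h
    proof -
      show "0 \<le> y g h" using g(1) A by (auto simp: y_def D_def intro!: sum_nonneg)
      have "y g h \<le> (\<Sum>z\<in>X. g z * 1)"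
        unfolding y_def using g(1) A by (intro sum_mono mult_left_mono) (auto simp: D_def)
      then show "y g h \<le> 1" using g(1) by (simp add: D_def)
    qed
    have step: "(max 0 (v - y g' h))\<^sup>2 \<le> (w h)\<^sup>2 - 2 * \<epsilon> * (w h * (A h x - y g h)) + \<epsilon>\<^sup>2" for h
    proof -
      define z where "z = A h x - y g h"
      have "\<bar>z\<bar> \<le> 1" using y01[of h] A[of h x] by (auto simp: z_def abs_le_iff)
      then have "z\<^sup>2 \<le> 1" using abs_square_le_1 by blast
      then have "(- (\<epsilon> * z))\<^sup>2 \<le> \<epsilon>\<^sup>2" by (simp add: power_mult_distrib mult_left_le)
      moreover have "v - y g' h = (v - y g h) + - (\<epsilon> * z)" by (simp add: y' z_def)
      then have "(max 0 (v - y g' h))\<^sup>2 \<le> (w h)\<^sup>2 + 2 * w h * - (\<epsilon> * z) + (- (\<epsilon> * z))\<^sup>2"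
        unfolding w_def by (metis max_0_add_power2_le)
      ultimately show ?thesis by (simp add: z_def[symmetric] mult_ac)
    qed
    \<comment> \<open>Where \<open>w h\<close> is nonzero it equals \<open>v - y g h\<close>, so one
      factor of its square can be replaced. The best response \<open>x\<close> then bounds the
      linear gain below by \<open>\<Phi> g\<close>, hence by \<open>I\<close>.\<close>
    have "\<Phi> g = (\<Sum>h\<in>H. w h * (v - y g h))"
      unfolding \<Phi>_def w_def by (intro sum.cong) (auto simp: max_def power2_eq_square)
    also have "\<dots> = v * (\<Sum>h\<in>H. w h) - (\<Sum>h\<in>H. w h * y g h)"
      by (simp add: sum_subtractf sum_distrib_left algebra_simps)
    also have "\<dots> \<le> (\<Sum>h\<in>H. w h * (A h x - y g h))"
      using x(2) by (simp add: sum_subtractf algebra_simps)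
    finally have gain: "\<Phi> g \<le> (\<Sum>h\<in>H. w h * (A h x - y g h))" .
    have "\<Phi> g' \<le> (\<Sum>h\<in>H. (w h)\<^sup>2 - 2 * \<epsilon> * (w h * (A h x - y g h)) + \<epsilon>\<^sup>2)"
      unfolding \<Phi>_def by (intro sum_mono step)
    also have "\<dots> = \<Phi> g - 2 * \<epsilon> * (\<Sum>h\<in>H. w h * (A h x - y g h)) + N * \<epsilon>\<^sup>2"
      by (simp add: sum.distrib sum_subtractf sum_distrib_left \<Phi>_def w_def N_def)
    also have "\<dots> \<le> \<Phi> g - 2 * \<epsilon> * I + \<epsilon> * I"
    proof -
      have "2 * \<epsilon> * I \<le> 2 * \<epsilon> * (\<Sum>h\<in>H. w h * (A h x - y g h))"
        using gain I_le[OF g(1)] \<epsilon> by (intro mult_left_mono) auto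
      moreover have "N * \<epsilon>\<^sup>2 \<le> \<epsilon> * I"
        using mult_left_mono[OF \<epsilon>N, of \<epsilon>] \<epsilon> by (simp add: power2_eq_square algebra_simps)
      ultimately show ?thesis by linarith
    qed
    also have "\<dots> < I" using g(2) by linarith
    finally show False using I_le[OF \<open>g' \<in> D\<close>] by simp
  qed
  \<comment> \<open>Once the whole potential is below \<open>(v - u)\<^sup>2\<close>, so is each of
    its terms, and no deficit \<open>v - y g h\<close> reaches \<open>v - u\<close>.\<close>
  then have "Inf (\<Phi> ` D) < (v - u)\<^sup>2" using \<open>u < v\<close> by (simp add: I_def order_le_less_trans)
  then obtain g where g: "g \<in> D" "\<Phi> g < (v - u)\<^sup>2"
    using cInf_lessD[OF neD] by auto
  have "u \<le> y g h" if "h \<in> H" for h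
  proof -
    have "(max 0 (v - y g h))\<^sup>2 \<le> \<Phi> g"
      unfolding \<Phi>_def by (rule member_le_sum[OF that]) (use finH in auto)
    also note g(2)
    finally have "max 0 (v - y g h) < v - u"
      by (rule power_less_imp_less_base) (use \<open>u < v\<close> in simp)
    then show ?thesis by simp
  qed
  with g(1) show thesis by (intro that[of g]) (auto simp: D_def y_def)
qed

section \<open>Left ends and heavy points\<close>

lemma d_interval_left_ends:
  assumes "d_interval d h"
  obtains L where "finite L" "card L \<le> d" "\<And>y. y \<in> h \<Longrightarrow> \<exists>a\<in>L. a \<le> y \<and> {a..y} \<subseteq> h"
proof -
  obtain J where J: "finite J" "card J \<le> d" "\<forall>I\<in>J. \<exists>a b. a \<le> b \<and> I = {a..b}" "h = \<Union>J"
    using assms unfolding d_interval_def by auto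
  show thesis
  proof (rule that[of "Inf ` J"])
    show "finite (Inf ` J)" "card (Inf ` J) \<le> d"
      using J(1,2) card_image_le[OF J(1), of Inf] by auto
    fix y assume "y \<in> h"
    then obtain I where I: "I \<in> J" "y \<in> I" using J(4) by auto
    then obtain a b where ab: "a \<le> b" "I = {a..b}" using J(3) by blast
    then have "Inf I = a" by simp
    moreover have "{a..y} \<subseteq> h" using J(4) I ab by auto
    ultimately show "\<exists>a\<in>Inf ` J. a \<le> y \<and> {a..y} \<subseteq> h" using I ab by force
  qed
qed

text \<open>Among the left ends below \<open>y\<close> chosen for the members, the largest lies
  between each of the others and \<open>y\<close>, hence in every member. Indexing by
  \<open>S\<close> allows repeated members.\<close>

lemma common_left_end:
  fixes h :: "'i \<Rightarrow> real set"
  assumes "finite S" "S \<noteq> {}" "y \<in> (\<Inter>i\<in>S. h i)"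
    and L: "\<And>i z. i \<in> S \<Longrightarrow> z \<in> h i \<Longrightarrow> \<exists>a\<in>L (h i). a \<le> z \<and> {a..z} \<subseteq> h i"
  shows "\<exists>i\<in>S. \<exists>x\<in>L (h i). \<forall>j\<in>S. x \<in> h j"
proof -
  have "\<forall>i\<in>S. \<exists>a\<in>L (h i). a \<le> y \<and> {a..y} \<subseteq> h i" using assms by blast
  then obtain a where a: "\<And>i. i \<in> S \<Longrightarrow> a i \<in> L (h i) \<and> a i \<le> y \<and> {a i..y} \<subseteq> h i"
    by metis
  have "Max (a ` S) \<in> a ` S" using assms by (intro Max_in) auto
  then obtain i where i: "i \<in> S" "a i = Max (a ` S)" by auto
  have "a i \<in> h j" if "j \<in> S" for j
  proof -
    have "a j \<le> a i" using i that assms(1) by simp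
    then show ?thesis using a[OF that] a[OF i(1)] by auto
  qed
  then show ?thesis using i(1) a by blast
qed

text \<open>The property concerns exactly \<open>p\<close> distinct members, but a
  \<open>p\<close>-tuple with repetitions has fewer. As \<open>H\<close> has at least
  \<open>p\<close> members, \<open>S\<close> extends to a set of size \<open>p\<close>.\<close>

lemma pq_property_Inter:
  assumes pq: "pq_property p p H" and "finite H" "p \<le> card H" "S \<subseteq> H" "card S \<le> p"
  shows "\<Inter>S \<noteq> {}"
proof -
  obtain G where G: "S \<subseteq> G" "G \<subseteq> H" "card G = p"
    using exists_subset_between[of S p H] assms by auto
  have "finite G" using G(2) \<open>finite H\<close> finite_subset by blast
  then have "\<exists>G'\<subseteq>G. card G' = p \<and> \<Inter>G' \<noteq> {}"
    using pq G(2,3) unfolding pq_property_def by simp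
  then obtain G' where G': "G' \<subseteq> G" "card G' = p" "\<Inter>G' \<noteq> {}" by blast
  have "G' = G" using G' G(3) by (intro card_subset_eq \<open>finite G\<close>) simp_all
  with G'(3) have "\<Inter>G \<noteq> {}" by simp
  with Inter_anti_mono[OF G(1)] show ?thesis by blast
qed

text \<open>A \<open>p\<close>-tuple with a common point is charged to a coordinate \<open>i\<close>
  and a left end of its \<open>i\<close>-th member that lies in all the other members.\<close>

lemma weight_power_le:
  fixes f :: "real set \<Rightarrow> real"
  assumes finH: "finite H" and f: "\<And>h. 0 \<le> f h" and p: "0 < p"
    and finL: "\<And>h. h \<in> H \<Longrightarrow> finite (L h)" and cardL: "\<And>h. h \<in> H \<Longrightarrow> card (L h) \<le> d"
    and L: "\<And>h z. h \<in> H \<Longrightarrow> z \<in> h \<Longrightarrow> \<exists>a\<in>L h. a \<le> z \<and> {a..z} \<subseteq> h"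
    and inter: "\<And>S. S \<subseteq> H \<Longrightarrow> card S \<le> p \<Longrightarrow> \<Inter>S \<noteq> {}"
    and M: "\<And>h x. h \<in> H \<Longrightarrow> x \<in> L h \<Longrightarrow> (\<Sum>h' | h' \<in> H \<and> x \<in> h'. f h') \<le> M" and M0: "0 \<le> M"
  shows "(\<Sum>h\<in>H. f h) ^ p \<le> real p * real d * (\<Sum>h\<in>H. f h) * M ^ (p - 1)"
proof -
  define K where "K = {..<p} \<times> Sigma H L"
  \<comment> \<open>For \<open>k = (i, h, x)\<close> this describes a box of tuples: coordinate
    \<open>i\<close> is pinned to \<open>h\<close>, the others range freely over the members through
    \<open>x\<close>. The sum of \<open>\<pi>\<close> over a box factorises.\<close>
  define B where "B k j = (case k of (i, h, x) \<Rightarrow> if j = i then {h} else {h'\<in>H. x \<in> h'})"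
    for k :: "nat \<times> real set \<times> real" and j :: nat
  define \<pi> where "\<pi> t = (\<Prod>j<p. f (t j))" for t
  have finK: "finite K" using finH finL by (auto simp: K_def)
  have finB: "finite (B k j)" for k j using finH by (auto simp: B_def split: prod.split)
  have \<pi>: "0 \<le> \<pi> t" for t using f by (auto simp: \<pi>_def intro: prod_nonneg)
  have cover: "PiE {..<p} (\<lambda>_. H) \<subseteq> (\<Union>k\<in>K. PiE {..<p} (B k))"
  proof
    fix t assume t: "t \<in> PiE {..<p} (\<lambda>_. H)"
    have "t ` {..<p} \<subseteq> H" using t by auto
    moreover have "card (t ` {..<p}) \<le> p" using card_image_le[of "{..<p}" t] by simp
    ultimately obtain y where "y \<in> (\<Inter>j\<in>{..<p}. t j)" using inter by blast
    then have "\<exists>i\<in>{..<p}. \<exists>x\<in>L (t i). \<forall>j\<in>{..<p}. x \<in> t j"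
      using p t by (intro common_left_end[of _ y]) (auto intro!: L)
    then obtain i x where ix: "i < p" "x \<in> L (t i)" "\<forall>j<p. x \<in> t j" by auto
    have "t \<in> PiE {..<p} (B (i, t i, x))"
      using t ix by (auto simp: B_def PiE_iff)
    moreover have "(i, t i, x) \<in> K" using t ix by (auto simp: K_def)
    ultimately show "t \<in> (\<Union>k\<in>K. PiE {..<p} (B k))" by blast
  qed
  have "(\<Sum>h\<in>H. f h) ^ p = (\<Prod>j<p. \<Sum>h\<in>H. f h)" by simp
  also have "\<dots> = sum \<pi> (PiE {..<p} (\<lambda>_. H))"
    unfolding \<pi>_def by (rule prod_sum_PiE) (use finH in auto)
  also have "\<dots> \<le> sum \<pi> (\<Union>k\<in>K. PiE {..<p} (B k))"
    using cover finK finB \<pi> by (intro sum_mono2) (auto intro!: finite_PiE)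
  also have "\<dots> \<le> (\<Sum>k\<in>K. sum \<pi> (PiE {..<p} (B k)))"
    using finK finB \<pi> by (intro sum_UN_le) (auto intro!: finite_PiE)
  also have "\<dots> \<le> (\<Sum>(i, h, x)\<in>K. f h * M ^ (p - 1))"
  proof (rule sum_mono, clarify)
    fix i h x assume k: "(i, h, x) \<in> K"
    then have ihx: "i < p" "h \<in> H" "x \<in> L h" by (auto simp: K_def)
    have "sum \<pi> (PiE {..<p} (B (i, h, x))) = (\<Prod>j<p. \<Sum>h'\<in>B (i, h, x) j. f h')"
      unfolding \<pi>_def by (rule prod_sum_PiE[symmetric]) (use finB in auto)
    also have "\<dots> = f h * (\<Prod>j\<in>{..<p} - {i}. \<Sum>h' | h' \<in> H \<and> x \<in> h'. f h')"
      using ihx(1) by (subst prod.remove[of _ i]) (auto simp: B_def intro!: prod.cong)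
    also have "\<dots> = f h * (\<Sum>h' | h' \<in> H \<and> x \<in> h'. f h') ^ (p - 1)"
      using ihx(1) by simp
    also have "\<dots> \<le> f h * M ^ (p - 1)"
      using f M[OF ihx(2,3)] by (intro mult_left_mono power_mono sum_nonneg) auto
    finally show "sum \<pi> (PiE {..<p} (B (i, h, x))) \<le> f h * M ^ (p - 1)" .
  qed
  also have "\<dots> = (\<Sum>i<p. \<Sum>h\<in>H. \<Sum>x\<in>L h. f h * M ^ (p - 1))"
    unfolding K_def using finH finL
    by (subst sum.Sigma) (auto simp: sum.cartesian_product[symmetric] intro!: sum.cong)
  also have "\<dots> = real p * (\<Sum>h\<in>H. real (card (L h)) * (f h * M ^ (p - 1)))" by simp
  also have "\<dots> \<le> real p * (\<Sum>h\<in>H. real d * (f h * M ^ (p - 1)))"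
    using cardL f M0 by (intro mult_left_mono sum_mono mult_right_mono) auto
  also have "\<dots> = real p * real d * (\<Sum>h\<in>H. f h) * M ^ (p - 1)"
    by (simp add: sum_distrib_left sum_distrib_right algebra_simps)
  finally show ?thesis .
qed

text \<open>For positive total weight, one factor of it cancels in \<open>weight_power_le\<close>
  and a \<open>(p - 1)\<close>-th root remains to be taken; the maximum \<open>M\<close> is attained
  at some left end. This supplies the best response in \<open>approximate_minimax\<close>.\<close>

lemma heavy_left_end:
  fixes w :: "real set \<Rightarrow> real" and L :: "real set \<Rightarrow> real set"
  assumes finH: "finite H" and w: "\<And>h. 0 \<le> w h" and p: "1 < p" and d: "0 < d"
    and finL: "\<And>h. h \<in> H \<Longrightarrow> finite (L h)" and cardL: "\<And>h. h \<in> H \<Longrightarrow> card (L h) \<le> d"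
    and L: "\<And>h z. h \<in> H \<Longrightarrow> z \<in> h \<Longrightarrow> \<exists>a\<in>L h. a \<le> z \<and> {a..z} \<subseteq> h"
    and inter: "\<And>S. S \<subseteq> H \<Longrightarrow> card S \<le> p \<Longrightarrow> \<Inter>S \<noteq> {}"
    and ne: "(\<Union>h\<in>H. L h) \<noteq> {}"
  shows "\<exists>x\<in>(\<Union>h\<in>H. L h).
    (\<Sum>h\<in>H. w h) / (real p * real d) powr (1 / (real p - 1)) \<le> (\<Sum>h | h \<in> H \<and> x \<in> h. w h)"
proof -
  let ?X = "\<Union>h\<in>H. L h" and ?W = "\<Sum>h\<in>H. w h"
  define \<mu> where "\<mu> x = (\<Sum>h | h \<in> H \<and> x \<in> h. w h)" for x
  define M where "M = Max (\<mu> ` ?X)"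
  have finX: "finite ?X" using finH finL by auto
  have "M \<in> \<mu> ` ?X" unfolding M_def using finX ne by (intro Max_in) auto
  then obtain x where x: "x \<in> ?X" "\<mu> x = M" by auto
  have M0: "0 \<le> M" unfolding x(2)[symmetric] \<mu>_def using w by (intro sum_nonneg) auto
  have "?W / (real p * real d) powr (1 / (real p - 1)) \<le> M"
  proof (cases "?W = 0")
    case False
    with w have W: "?W > 0" by (simp add: sum_nonneg less_le)
    have q: "real (p - 1) = real p - 1" using p by simp
    have "?W ^ p \<le> real p * real d * ?W * M ^ (p - 1)"
      by (rule weight_power_le[where L = L])
        (use assms M0 finX in \<open>auto simp: M_def \<mu>_def intro!: Max_ge\<close>)
    also have "?W ^ p = ?W * ?W ^ (p - 1)" using p by (simp add: power_eq_if)
    finally have "?W ^ (p - 1) \<le> real p * real d * M ^ (p - 1)"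
      using W by (simp add: mult.assoc mult.left_commute)
    also have "real p * real d = ((real p * real d) powr (1 / (real p - 1))) ^ (p - 1)"
      using p d by (simp add: powr_powr q flip: powr_realpow)
    finally have "?W ^ (p - 1) \<le> ((real p * real d) powr (1 / (real p - 1)) * M) ^ (p - 1)"
      by (simp add: power_mult_distrib)
    then have "?W \<le> (real p * real d) powr (1 / (real p - 1)) * M"
      using p M0 W by (subst (asm) power_mono_iff) auto
    then show ?thesis using p d by (simp add: divide_le_eq mult.commute)
  qed (use M0 in auto)
  with x show ?thesis by (auto simp: \<mu>_def)
qed

section \<open>Fractional covers of small total weight\<close>

text \<open>Minimax yields a probability weighting of the left ends under which every member has
  weight at least \<open>u\<close>; dividing by \<open>u\<close> makes it a cover of total weight
  \<open>1 / u\<close>.\<close>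

lemma fractional_cover_exists_less:
  assumes "finite H" "p \<le> card H" "\<forall>h\<in>H. d_interval d h" "pq_property p p H" "1 < p"
  obtains g where "fractional_cover H g" "(\<Sum>x | g x \<noteq> 0. g x) < (real p * real d) powr (1 / (real p - 1)) + 1"
proof -
  note inter = pq_property_Inter[OF assms(4,1,2)]
  obtain L where L: "\<And>h. h \<in> H \<Longrightarrow> finite (L h)" "\<And>h. h \<in> H \<Longrightarrow> card (L h) \<le> d"
    "\<And>h y. h \<in> H \<Longrightarrow> y \<in> h \<Longrightarrow> \<exists>a\<in>L h. a \<le> y \<and> {a..y} \<subseteq> h"
  proof -
    have "\<forall>h\<in>H. \<exists>L. finite L \<and> card L \<le> d \<and> (\<forall>y\<in>h. \<exists>a\<in>L. a \<le> y \<and> {a..y} \<subseteq> h)"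
      using assms(3) by (metis d_interval_left_ends)
    then obtain L where "\<forall>h\<in>H. finite (L h) \<and> card (L h) \<le> d \<and> (\<forall>y\<in>h. \<exists>a\<in>L h. a \<le> y \<and> {a..y} \<subseteq> h)"
      by metis
    then show thesis using that by blast
  qed
  obtain h0 where h0: "h0 \<in> H" using assms(2,5) by fastforce
  have "h0 \<noteq> {}" using inter[of "{h0}"] h0 assms(5) by auto
  then obtain a0 where a0: "a0 \<in> L h0" using L(3)[OF h0] by blast
  have d: "0 < d" using L(1,2)[OF h0] a0 by (metis card_gt_0_iff empty_iff less_le_trans)
  define X where "X = (\<Union>h\<in>H. L h)"
  have X: "finite X" "X \<noteq> {}" using a0 h0 assms(1) L(1) by (auto simp: X_def)
  define T where "T = (real p * real d) powr (1 / (real p - 1))"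
  have T: "0 < T" using d assms(5) by (simp add: T_def)
  \<comment> \<open>The \<open>1 / 2\<close> splits the slack: minimax requires
    \<open>u < 1 / T\<close>, and \<open>1 / u\<close> must stay below \<open>T + 1\<close>.\<close>
  define u where "u = 1 / (T + 1 / 2)"
  have u: "0 < u" "u < 1 / T" "1 / u < T + 1" using T by (auto simp: u_def field_simps)
  obtain g where g: "\<And>x. 0 \<le> g x" "(\<Sum>x\<in>X. g x) = 1"
    "\<And>h. h \<in> H \<Longrightarrow> u \<le> (\<Sum>x\<in>X. g x * of_bool (x \<in> h))"
  proof (rule approximate_minimax[OF assms(1) X, of "\<lambda>h x. of_bool (x \<in> h)" "1 / T" u])
    fix w :: "real set \<Rightarrow> real" assume "\<And>h. 0 \<le> w h"
    then have "\<exists>x\<in>(\<Union>h\<in>H. L h). (\<Sum>h\<in>H. w h) / T \<le> (\<Sum>h | h \<in> H \<and> x \<in> h. w h)"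
      unfolding T_def using assms d L inter X(2) by (intro heavy_left_end) (auto simp: X_def)
    moreover have "(\<Sum>h | h \<in> H \<and> x \<in> h. w h) = (\<Sum>h\<in>H. w h * of_bool (x \<in> h))" for x
      using assms(1) by (simp add: sum.inter_filter if_distrib of_bool_def cong: if_cong)
    ultimately show "\<exists>x\<in>X. 1 / T * (\<Sum>h\<in>H. w h) \<le> (\<Sum>h\<in>H. w h * of_bool (x \<in> h))"
      by (simp add: X_def)
  qed (use u in auto)
  \<comment> \<open>The values of \<open>g\<close> outside \<open>X\<close> are arbitrary; cutting
    them off makes the support finite.\<close>
  define g' where "g' x = (if x \<in> X then g x / u else 0)" for x
  have supp: "{x. g' x \<noteq> 0} \<subseteq> X" by (auto simp: g'_def)
  show thesis
  proof (rule that[of g'])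
    have "1 \<le> (\<Sum>x | x \<in> h \<and> g' x \<noteq> 0. g' x)" if "h \<in> H" for h
    proof -
      have "(\<Sum>x | x \<in> h \<and> g' x \<noteq> 0. g' x) = (\<Sum>x\<in>X. g' x * of_bool (x \<in> h))"
        using supp X(1) by (intro sum.mono_neutral_cong_left) auto
      also have "\<dots> = (\<Sum>x\<in>X. g x * of_bool (x \<in> h)) / u"
        by (simp add: g'_def sum_divide_distrib)
      finally show ?thesis using g(3)[OF that] u(1) by simp
    qed
    moreover have "0 \<le> g' x" for x using g(1) u(1) by (simp add: g'_def)
    ultimately show "fractional_cover H g'"
      unfolding fractional_cover_def using finite_subset[OF supp X(1)] by blast
    have "(\<Sum>x | g' x \<noteq> 0. g' x) = (\<Sum>x\<in>X. g' x)"
      using supp X(1) by (intro sum.mono_neutral_left) auto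
    also have "\<dots> = 1 / u" by (simp add: g'_def g(2) flip: sum_divide_distrib)
    finally show "(\<Sum>x | g' x \<noteq> 0. g' x) < (real p * real d) powr (1 / (real p - 1)) + 1"
      using u(3) by (simp add: T_def)
  qed
qed

section \<open>From fractional covers to covering points\<close>

lemma fractional_covering_number_le:
  assumes "fractional_cover H g"
  shows "fractional_covering_number H \<le> (\<Sum>x | g x \<noteq> 0. g x)"
  unfolding fractional_covering_number_def
proof (rule cInf_lower)
  show "bdd_below {(\<Sum>x | g x \<noteq> 0. g x) | g. fractional_cover H g}"
    by (rule bdd_belowI[of _ 0]) (auto simp: fractional_cover_def intro!: sum_nonneg)
qed (use assms in auto)

text \<open>Every member has a component of weight at least \<open>1 / d\<close>, and such an interval
  contains one of the points \<open>x i\<close> at which the cumulative weight first reaches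
  \<open>i / d\<close>.\<close>

lemma covering_number_le_fractional_cover:
  assumes H: "\<forall>h\<in>H. d_interval d h" and g: "fractional_cover H g"
  shows "real (covering_number H) \<le> real d * (\<Sum>x | g x \<noteq> 0. g x)"
proof -
  define S where "S = {x. g x \<noteq> 0}"
  define T where "T = (\<Sum>x\<in>S. g x)"
  define F where "F t = (\<Sum>x | x \<in> S \<and> x \<le> t. g x)" for t
  have S: "finite S" and g0: "\<And>x. 0 \<le> g x" using g by (auto simp: fractional_cover_def S_def)
  define x where "x i = Min {t\<in>S. real i \<le> real d * F t}" for i
  define n where "n = nat \<lfloor>real d * T\<rfloor>"
  have T0: "0 \<le> T" unfolding T_def using g0 by (intro sum_nonneg) auto
  have "\<exists>i\<in>{1..n}. x i \<in> h" if "h \<in> H" for h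
  proof -
    have "d_interval d h" using H that by blast
    then obtain J where J: "finite J" "card J \<le> d" "\<forall>I\<in>J. \<exists>a b. a \<le> b \<and> I = {a..b}" "h = \<Union>J"
      unfolding d_interval_def by auto
    have "1 \<le> sum g (\<Union>I\<in>J. I \<inter> S)"
    proof -
      have "(\<Union>I\<in>J. I \<inter> S) = {x. x \<in> h \<and> g x \<noteq> 0}" by (auto simp: J(4) S_def)
      then show ?thesis using g that by (simp add: fractional_cover_def)
    qed
    also have "\<dots> \<le> (\<Sum>I\<in>J. sum g (I \<inter> S))"
      using J(1) S g0 by (intro sum_UN_le) auto
    finally have sumJ: "1 \<le> (\<Sum>I\<in>J. sum g (I \<inter> S))" .
    have "\<exists>I\<in>J. 1 \<le> real d * sum g (I \<inter> S)"
    proof (rule ccontr)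
      assume "\<not> ?thesis"
      then have less: "\<And>I. I \<in> J \<Longrightarrow> real d * sum g (I \<inter> S) < 1" by force
      have "J \<noteq> {}" using sumJ by auto
      then have "(\<Sum>I\<in>J. real d * sum g (I \<inter> S)) < (\<Sum>I\<in>J. 1)"
        using J(1) less by (intro sum_strict_mono) auto
      also have "\<dots> \<le> real d" using J(2) by simp
      also have "\<dots> \<le> real d * (\<Sum>I\<in>J. sum g (I \<inter> S))" using mult_left_mono[OF sumJ, of "real d"] by simp
      finally show False by (simp add: sum_distrib_left)
    qed
    then obtain a b where ab: "a \<le> b" "{a..b} \<in> J" "1 \<le> real d * sum g ({a..b} \<inter> S)"
      using J(3) by fastforce
    \<comment> \<open>\<open>r\<close> is \<open>d\<close> times the weight strictly left of
      \<open>a\<close>, and \<open>i\<close> is the least integer above it. The interval contributes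
      at least 1 after scaling by \<open>d\<close>, so level \<open>i\<close> is first reached
      inside it.\<close>
    define r where "r = real d * (\<Sum>x | x \<in> S \<and> x < a. g x)"
    define i where "i = nat \<lfloor>r\<rfloor> + 1"
    have r0: "0 \<le> r" unfolding r_def using g0 by (intro mult_nonneg_nonneg sum_nonneg) auto
    then have i: "r < real i" "real i \<le> r + 1" by (auto simp: i_def) linarith
    have "{x. x \<in> S \<and> x \<le> b} = {x. x \<in> S \<and> x < a} \<union> ({a..b} \<inter> S)" using ab(1) by auto
    then have "F b = (\<Sum>x | x \<in> S \<and> x < a. g x) + sum g ({a..b} \<inter> S)"
      unfolding F_def using S by (simp add: sum.union_disjoint disjoint_iff)
    then have Fb: "real i \<le> real d * F b"
      using i ab(3) by (simp add: r_def distrib_left)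
    \<comment> \<open>\<open>x i\<close> is sought among support points, and \<open>b\<close> need
      not be one. The largest support point up to \<open>b\<close> has the same cumulative weight
      and serves instead.\<close>
    let ?Q = "{t\<in>S. real i \<le> real d * F t}" and ?B = "{t\<in>S. t \<le> b}"
    have "F b \<noteq> 0" using Fb by (intro notI) (simp add: i_def)
    then have "?B \<noteq> {}" unfolding F_def by (metis sum.empty)
    then have "Max ?B \<in> ?B" using S by (intro Max_in) auto
    moreover have "F (Max ?B) = F b"
    proof -
      have "{x. x \<in> S \<and> x \<le> Max ?B} = {x. x \<in> S \<and> x \<le> b}"
        using S \<open>Max ?B \<in> ?B\<close> by (auto intro: Max_ge)
      then show ?thesis by (simp add: F_def)
    qed
    ultimately have maxB: "Max ?B \<in> ?Q" "Max ?B \<le> b" using Fb by auto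
    have finQ: "finite ?Q" using S by simp
    have "x i \<le> Max ?B" unfolding x_def by (rule Min_le[OF finQ maxB(1)])
    with maxB(2) have le: "x i \<le> b" by simp
    have Q: "x i \<in> ?Q" unfolding x_def by (rule Min_in[OF finQ]) (use maxB(1) in blast)
    have "a \<le> x i"
    proof (rule ccontr)
      assume "\<not> a \<le> x i"
      then have "F (x i) \<le> (\<Sum>x | x \<in> S \<and> x < a. g x)"
        unfolding F_def using S g0 by (intro sum_mono2) auto
      then have "real d * F (x i) \<le> r" by (simp add: r_def mult_left_mono)
      with Q i(1) show False by simp
    qed
    moreover have "i \<le> n"
    proof -
      have "F b \<le> T" unfolding F_def T_def using S g0 by (intro sum_mono2) auto
      then have "real i \<le> real d * T" using Fb mult_left_mono[of "F b" T "real d"] by simp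
      then show ?thesis by (simp add: n_def le_nat_floor)
    qed
    ultimately have "i \<in> {1..n}" "x i \<in> {a..b}" using le by (auto simp: i_def)
    then show ?thesis using ab(2) J(4) by blast
  qed
  then have "\<forall>h\<in>H. h \<inter> x ` {1..n} \<noteq> {}" by blast
  then have "covering_number H \<le> card (x ` {1..n})"
    unfolding covering_number_def by (intro Least_le) auto
  also have "\<dots> \<le> n" using card_image_le[of "{1..n}" x] by simp
  finally have "real (covering_number H) \<le> real n" by simp
  also have "\<dots> \<le> real d * T" using T0 by (simp add: n_def)
  finally show ?thesis by (simp add: T_def S_def)
qed

text \<open>One cover of total weight strictly below the first bound gives both claims; multiplying
  by \<open>d\<close> raises the exponent \<open>1 / (p - 1)\<close> to
  \<open>p / (p - 1)\<close>.\<close>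

lemma covering_numbers_less:
  assumes "finite H" "p \<le> card H" "\<forall>h\<in>H. d_interval d h" "pq_property p p H" "1 < p"
  shows "fractional_covering_number H < real p powr (1 / (real p - 1)) * real d powr (1 / (real p - 1)) + 1"
    and "real (covering_number H) < real p powr (1 / (real p - 1)) * real d powr (real p / (real p - 1)) + real d"
proof -
  obtain g where g: "fractional_cover H g"
    "(\<Sum>x | g x \<noteq> 0. g x) < (real p * real d) powr (1 / (real p - 1)) + 1" (is "?T < _")
    using fractional_cover_exists_less[OF assms] by blast
  then have T: "?T < real p powr (1 / (real p - 1)) * real d powr (1 / (real p - 1)) + 1"
    by (simp add: powr_mult)
  then show "fractional_covering_number H < real p powr (1 / (real p - 1)) * real d powr (1 / (real p - 1)) + 1"
    using fractional_covering_number_le[OF g(1)] by simp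
  \<comment> \<open>Strictness survives multiplication by \<open>d\<close> only for positive
    \<open>d\<close>. If \<open>d = 0\<close>, every member is empty, so \<open>H\<close> has at
    most one member, fewer than \<open>p\<close>.\<close>
  have "d > 0"
  proof (rule ccontr)
    assume "\<not> d > 0"
    then have "H \<subseteq> {{}}" using assms(3) by (auto simp: d_interval_def)
    then have "card H \<le> 1" using card_mono[of "{{}}" H] by simp
    with assms show False by simp
  qed
  have "real (covering_number H) \<le> real d * ?T"
    by (rule covering_number_le_fractional_cover[OF assms(3) g(1)])
  also have "\<dots> < real d * (real p powr (1 / (real p - 1)) * real d powr (1 / (real p - 1)) + 1)"
    using T \<open>d > 0\<close> by simp
  also have "\<dots> = real p powr (1 / (real p - 1)) * (real d powr 1 * real d powr (1 / (real p - 1))) + real d"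
    using \<open>d > 0\<close> by (simp add: algebra_simps)
  also have "real d powr 1 * real d powr (1 / (real p - 1)) = real d powr (real p / (real p - 1))"
    using assms(5) by (subst powr_add[symmetric]) (simp add: field_simps)
  finally show "real (covering_number H) < real p powr (1 / (real p - 1)) * real d powr (real p / (real p - 1)) + real d" .
qed

section \<open>Sharpness of the fractional bound\<close>

text \<open>Double counting: adding up the covering inequalities of all members uses each weight
  \<open>g x\<close> at most \<open>p\<close> times. The cover \<open>g0\<close> ensures that the
  infimum is over a nonempty set.\<close>

lemma fractional_covering_number_ge_card:
  assumes finF: "finite F" and cover: "fractional_cover F g0"
    and deg: "\<And>x. card {h\<in>F. x \<in> h} \<le> p" and "p > 0"
  shows "real (card F) / real p \<le> fractional_covering_number F"
  unfolding fractional_covering_number_def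
proof (rule cInf_greatest)
  fix s assume "s \<in> {(\<Sum>x | g x \<noteq> 0. g x) | g. fractional_cover F g}"
  then obtain g where s: "s = (\<Sum>x | g x \<noteq> 0. g x)" and g: "fractional_cover F g" by auto
  define S where "S = {x. g x \<noteq> 0}"
  have S: "finite S" and g0: "\<And>x. 0 \<le> g x" using g by (auto simp: fractional_cover_def S_def)
  have "real (card F) = (\<Sum>h\<in>F. 1)" by simp
  also have "\<dots> \<le> (\<Sum>h\<in>F. \<Sum>x | x \<in> h \<and> g x \<noteq> 0. g x)"
    using g by (intro sum_mono) (auto simp: fractional_cover_def)
  also have "\<dots> = (\<Sum>h\<in>F. \<Sum>x\<in>S. if x \<in> h then g x else 0)"
    using S by (intro sum.cong refl sum.mono_neutral_cong_left) (auto simp: S_def)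
  also have "\<dots> = (\<Sum>x\<in>S. \<Sum>h\<in>F. if x \<in> h then g x else 0)" by (rule sum.swap)
  also have "\<dots> = (\<Sum>x\<in>S. real (card {h\<in>F. x \<in> h}) * g x)"
    using finF by (simp flip: sum.inter_filter)
  also have "\<dots> \<le> (\<Sum>x\<in>S. real p * g x)"
    using deg g0 by (intro sum_mono mult_right_mono) auto
  also have "\<dots> = real p * s" by (simp add: s S_def sum_distrib_left)
  finally show "real (card F) / real p \<le> s" using \<open>p > 0\<close> by (simp add: divide_le_eq mult.commute)
qed (use cover in auto)

lemma d_interval_finite:
  assumes "finite h" "card h \<le> d"
  shows "d_interval d h"
  unfolding d_interval_def
proof (intro exI conjI)
  show "finite ((\<lambda>x. {x..x}) ` h)" "card ((\<lambda>x. {x..x}) ` h) \<le> d"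
    using assms card_image_le[of h "\<lambda>x. {x..x}"] by auto
  show "\<forall>I\<in>(\<lambda>x. {x..x}) ` h. \<exists>a b. a \<le> b \<and> I = {a..b}" by blast
qed (auto simp: pairwise_def disjnt_def)

text \<open>One point \<open>e S\<close> for every \<open>p\<close>-subset \<open>S\<close> of
  \<open>{..<n}\<close>; the \<open>i\<close>-th member consists of the points \<open>e S\<close> with
  \<open>i \<in> S\<close>, so that every point lies in exactly \<open>p\<close> of the \<open>n\<close>
  members.\<close>

lemma pq_family_large_fractional_covering_number:
  assumes p: "1 < p" and n: "p < n"
  obtains F :: "real set set" where "finite F" "p \<le> card F" "\<forall>h\<in>F. d_interval (n ^ (p - 1)) h"
    "pq_property p p F" "real n / real p \<le> fractional_covering_number F"
proof -
  define \<P> where "\<P> = {S. S \<subseteq> {..<n} \<and> card S = p}"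
  have fin\<P>: "finite \<P>" by (simp add: \<P>_def)
  obtain e0 :: "nat set \<Rightarrow> nat" where e0: "inj_on e0 \<P>"
    using finite_imp_inj_to_nat_seg[OF fin\<P>] by blast
  define e where "e S = real (e0 S)" for S
  have e: "e S = e S' \<longleftrightarrow> S = S'" if "S \<in> \<P>" "S' \<in> \<P>" for S S'
    using e0 that by (auto simp: e_def inj_on_def)
  define m where "m i = e ` {S\<in>\<P>. i \<in> S}" for i
  have m: "e S \<in> m i \<longleftrightarrow> i \<in> S" if "S \<in> \<P>" for S i
    using e that by (auto simp: m_def)
  \<comment> \<open>Since \<open>p < n\<close>, some \<open>p\<close>-subset contains
    \<open>i\<close> and avoids \<open>j\<close>; its point separates the two members.\<close>
  have inj: "inj_on m {..<n}"
  proof (rule inj_onI, rule ccontr)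
    fix i j assume ij: "i \<in> {..<n}" "j \<in> {..<n}" "m i = m j" "i \<noteq> j"
    have "\<exists>S. {i} \<subseteq> S \<and> S \<subseteq> {..<n} - {j} \<and> card S = p"
      by (rule exists_subset_between) (use p n ij in auto)
    then obtain S where S: "{i} \<subseteq> S" "S \<subseteq> {..<n} - {j}" "card S = p" by blast
    then have "S \<in> \<P>" by (auto simp: \<P>_def)
    with S m[of S i] m[of S j] ij show False by auto
  qed
  define F where "F = m ` {..<n}"
  have cardF: "card F = n" unfolding F_def using card_image[OF inj] by simp
  \<comment> \<open>The binomial coefficient is relaxed to a power whose \<open>(p - 1)\<close>-th
    root is exactly \<open>n\<close>.\<close>
  have card_m: "card (m i) \<le> n ^ (p - 1)" if "i < n" for i
  proof -
    have "card (m i) \<le> card {S\<in>\<P>. i \<in> S}" unfolding m_def by (rule card_image_le) (simp add: fin\<P>)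
    also have "\<dots> \<le> card {A. A \<subseteq> {..<n} \<and> card A = p - 1}"
    proof (rule card_inj_on_le[of "\<lambda>S. S - {i}"])
      show "inj_on (\<lambda>S. S - {i}) {S\<in>\<P>. i \<in> S}" by (auto simp: inj_on_def)
    qed (auto simp: \<P>_def)
    also have "\<dots> = n choose (p - 1)" by (simp add: n_subsets)
    also have "\<dots> \<le> n ^ (p - 1)" using n by (intro binomial_le_pow) simp
    finally show ?thesis .
  qed
  have deg: "card {h\<in>F. x \<in> h} \<le> p" for x
  proof (cases "x \<in> e ` \<P>")
    case True
    then obtain S where S: "S \<in> \<P>" "x = e S" by auto
    then have "{h\<in>F. x \<in> h} \<subseteq> m ` S" "finite S" "card S = p"
      using m finite_subset[of S "{..<n}"] by (auto simp: F_def \<P>_def)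
    then show ?thesis using card_image_le[of S m] card_mono[of "m ` S" "{h\<in>F. x \<in> h}"] by simp
  next
    case False
    then have "{h\<in>F. x \<in> h} = {}" by (auto simp: F_def m_def)
    then show ?thesis by (simp only: card.empty)
  qed
  \<comment> \<open>Weight 1 on every point is a crude cover, enough to show that covers
    exist.\<close>
  have cover: "fractional_cover F (\<lambda>x. of_bool (x \<in> e ` \<P>))"
  proof -
    have "1 \<le> card {x \<in> h. x \<in> e ` \<P>}" if h: "h \<in> F" for h
    proof -
      obtain i where i: "i < n" "h = m i" using h by (auto simp: F_def)
      have "\<exists>S. {i} \<subseteq> S \<and> S \<subseteq> {..<n} \<and> card S = p"
        by (rule exists_subset_between) (use p n i in auto)
      then obtain S where S: "{i} \<subseteq> S" "S \<subseteq> {..<n}" "card S = p" by blast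
      then have "S \<in> \<P>" by (auto simp: \<P>_def)
      then have "e S \<in> {x \<in> h. x \<in> e ` \<P>}" using m S i by auto
      moreover have "finite {x \<in> h. x \<in> e ` \<P>}" using fin\<P> by simp
      ultimately show ?thesis using card_gt_0_iff[of "{x \<in> h. x \<in> e ` \<P>}"] by (auto simp: Suc_le_eq)
    qed
    moreover have "(\<Sum>x | x \<in> h \<and> of_bool (x \<in> e ` \<P>) \<noteq> (0::real). of_bool (x \<in> e ` \<P>))
        = real (card {x \<in> h. x \<in> e ` \<P>})" for h
    proof -
      have "(\<Sum>x | x \<in> h \<and> of_bool (x \<in> e ` \<P>) \<noteq> (0::real). of_bool (x \<in> e ` \<P>))
          = (\<Sum>x | x \<in> h \<and> x \<in> e ` \<P>. 1::real)"
        by (rule sum.cong) (auto simp del: image_iff)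
      then show ?thesis by simp
    qed
    ultimately have "1 \<le> (\<Sum>x | x \<in> h \<and> of_bool (x \<in> e ` \<P>) \<noteq> (0::real). of_bool (x \<in> e ` \<P>) :: real)"
      if "h \<in> F" for h
      using that by (metis of_nat_1 of_nat_mono)
    moreover have "finite {x. of_bool (x \<in> e ` \<P>) \<noteq> (0::real)}"
      using fin\<P> by (simp del: image_iff)
    moreover have "0 \<le> (of_bool (x \<in> e ` \<P>) :: real)" for x by simp
    ultimately show ?thesis unfolding fractional_cover_def by blast
  qed
  show thesis
  proof (rule that[of F])
    show "finite F" "p \<le> card F" using n by (simp_all add: F_def cardF[unfolded F_def])
    show "\<forall>h\<in>F. d_interval (n ^ (p - 1)) h"
      using card_m fin\<P> by (auto simp: F_def m_def intro!: d_interval_finite)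
    show "pq_property p p F"
      unfolding pq_property_def
    proof (intro allI impI)
      fix G assume G: "G \<subseteq> F" "finite G \<and> card G = p"
      then obtain S where S: "S \<subseteq> {..<n}" "G = m ` S" unfolding F_def by (meson subset_imageE)
      then have "card S = p" using G inj by (metis card_image inj_on_subset)
      then have "S \<in> \<P>" using S by (simp add: \<P>_def)
      then have "e S \<in> \<Inter>G" using m S by auto
      with G show "\<exists>G'\<subseteq>G. card G' = p \<and> \<Inter>G' \<noteq> {}" by blast
    qed
    show "real n / real p \<le> fractional_covering_number F"
      using fractional_covering_number_ge_card[OF \<open>finite F\<close> cover deg] p cardF by simp
  qed
qed

theorem theorem1p1:
  fixes p :: nat
  assumes "p > 1"
  shows "(\<forall>(d::nat) (H :: real set set).
            finite H \<and> p \<le> card H \<and> (\<forall>h\<in>H. d_interval d h) \<and> pq_property p p H \<longrightarrow>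
              fractional_covering_number H
                < real p powr (1 / (real p - 1)) * real d powr (1 / (real p - 1)) + 1 \<and>
              real (covering_number H)
                < real p powr (1 / (real p - 1)) * real d powr (real p / (real p - 1)) + real d) \<and>
         (\<exists>c::real. c > 0 \<and>
            infinite {d::nat. \<exists>F :: real set set.
              finite F \<and> p \<le> card F \<and> (\<forall>h\<in>F. d_interval d h) \<and> pq_property p p F \<and>
              fractional_covering_number F \<ge> c * real d powr (1 / (real p - 1))})"
    (is "?upper \<and> (\<exists>c. c > 0 \<and> infinite (?D c))")
proof
  show ?upper using covering_numbers_less assms by blast
  \<comment> \<open>For \<open>d = n ^ (p - 1)\<close> the root of \<open>d\<close> is
    \<open>n\<close>, so the lower bound \<open>n / p\<close> gives the constant
    \<open>1 / p\<close>, the same for all \<open>n\<close>. Distinct \<open>n\<close> give distinct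
    \<open>d\<close>.\<close>
  have "n ^ (p - 1) \<in> ?D (1 / real p)" if pn: "n > p" for n
  proof -
    have root: "real (n ^ (p - 1)) powr (1 / (real p - 1)) = real n"
      using assms pn by (simp add: powr_powr of_nat_diff flip: powr_realpow)
    obtain F :: "real set set" where "finite F" "p \<le> card F" "\<forall>h\<in>F. d_interval (n ^ (p - 1)) h"
      "pq_property p p F" "real n / real p \<le> fractional_covering_number F"
      by (rule pq_family_large_fractional_covering_number[OF assms pn])
    moreover from this(5)
    have "1 / real p * real (n ^ (p - 1)) powr (1 / (real p - 1)) \<le> fractional_covering_number F"
      unfolding root by simp
    ultimately show ?thesis by blast
  qed
  then have "(\<lambda>n. n ^ (p - 1)) ` {p<..} \<subseteq> ?D (1 / real p)" by auto
  moreover have "infinite ((\<lambda>n. n ^ (p - 1)) ` {p<..})"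
  proof
    have "inj_on (\<lambda>n. n ^ (p - 1)) {p<..}"
      using assms by (intro inj_onI) (simp add: power_eq_iff_eq_base)
    moreover assume "finite ((\<lambda>n. n ^ (p - 1)) ` {p<..})"
    ultimately have "finite {p<..}" by (rule finite_imageD[rotated])
    then show False using infinite_Ioi by blast
  qed
  ultimately have "infinite (?D (1 / real p))" using finite_subset by blast
  then show "\<exists>c. c > 0 \<and> infinite (?D c)" using assms by (intro exI[of _ "1 / real p"]) simp
qed

end
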